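(* Let a weak almost-contact metric structure $(f,Q,\xi,\eta,g)$ on a smooth manifold $M^{2n+1}$ satisfy $\nabla_\xi\,f=0$. Then for all $X,Y\in\mathfrak{X}_M$ $$g(hX,Y)-g(hY,X)=-\tfrac12\,\mathcal{N}^{(2)}(X,Y);$$ hence, $h$ is self-adjoint if and only if $\mathcal{N}^{(2)}\equiv0$.
   Context: $\mathfrak{X}_M$ denotes the Lie algebra of smooth vector fields on a smooth manifold $M$ of dimension $2n+1$, and $\nabla$ is the Levi-Civita connection of $g$. A weak almost-contact metric structure $(f,Q,\xi,\eta,g)$ on $M^{2n+1}$ consists of a $(1,1)$-tensor $f$, a nonsingular $(1,1)$-tensor $Q$, a vector field $\xi$, a 1-form $\eta$ and a Riemannian metric $g$ such that $f^2=-Q+\eta\otimes\xi$, $\eta(\xi)=1$, $g(fX,fY)=g(X,QY)-\eta(X)\eta(Y)$, $\eta(X)=g(\xi,X)$ for all $X,Y\in\mathfrak{X}_M$. (Then $f\xi=0$, $\eta\circ f=0$, $\eta\circ Q=\eta$, $Q\xi=\xi$, $Qf=fQ$, $f$ is skew-symmetric, $Q$ is self-adjoint and positive definite, and ${\rm rank}\,f=2n$.) The $(1,1)$-tensor $h$ is $h=\frac12\,\mathcal{L}_\xi f$, where $(\mathcal{L}_Z f)X=[Z,fX]-f[Z,X]$. The tensor $\mathcal{N}^{(2)}$ is defined by $\mathcal{N}^{(2)}(X,Y)=(\mathcal{L}_{fX}\,\eta)(Y)-(\mathcal{L}_{fY}\,\eta)(X)=2\,d\eta(fX,Y)-2\,d\eta(fY,X)$,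 where $\mathcal{L}$ is the Lie derivative and $2\,d\eta(X,Y)=X(\eta(Y))-Y(\eta(X))-\eta([X,Y])$. *)

theory Defs
  imports "HOL-Analysis.Analysis" "HOL-Library.Function_Algebras"
begin

section \<open>Smooth manifolds\<close>

fun Ck_on :: "nat \<Rightarrow> 'e::euclidean_space set \<Rightarrow> ('e \<Rightarrow> 'f::real_normed_vector) \<Rightarrow> bool" where
  "Ck_on 0 S f \<longleftrightarrow> continuous_on S f"
| "Ck_on (Suc k) S f \<longleftrightarrow>
     (\<forall>x\<in>S. f differentiable (at x)) \<and>
     (\<forall>v. Ck_on k S (\<lambda>x. frechet_derivative f (at x) v))"

text \<open>Only used for open sets \<open>S\<close>.\<close>

definition smooth_on :: "'e::euclidean_space set \<Rightarrow> ('e \<Rightarrow> 'f::real_normed_vector) \<Rightarrow> bool" where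
  "smooth_on S f \<longleftrightarrow> (\<forall>k. Ck_on k S f)"

type_synonym ('m, 'e) chart = "'m set \<times> ('m \<Rightarrow> 'e)"

definition is_chart :: "('m::topological_space, 'e::euclidean_space) chart \<Rightarrow> bool" where
  "is_chart c \<longleftrightarrow> (case c of (U, \<phi>) \<Rightarrow>
     open U \<and> open (\<phi> ` U) \<and> homeomorphism U (\<phi> ` U) \<phi> (inv_into U \<phi>))"

text \<open>
  The manifold is the whole type \<open>'m\<close>, which is Hausdorff and second countable, and its
  smooth structure is the one generated by the atlas. Its dimension is \<open>DIM('e)\<close>.
\<close>

definition smooth_atlas ::
    "('m::{t2_space, second_countable_topology}, 'e::euclidean_space) chart set \<Rightarrow> bool" where
  "smooth_atlas A \<longleftrightarrow>
     (\<forall>c\<in>A. is_chart c) \<and> (\<Union>c\<in>A. fst c) = UNIV \<and>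
     (\<forall>(U, \<phi>)\<in>A. \<forall>(V, \<psi>)\<in>A. smooth_on (\<phi> ` (U \<inter> V)) (\<psi> \<circ> inv_into U \<phi>))"

definition smooth_funs ::
    "('m::topological_space, 'e::euclidean_space) chart set \<Rightarrow> ('m \<Rightarrow> real) set" where
  "smooth_funs A = {u. \<forall>(U, \<phi>)\<in>A. smooth_on (\<phi> ` U) (u \<circ> inv_into U \<phi>)}"


section \<open>Tangent vectors and vector fields\<close>

text \<open>
  Sums, differences, products and constants \<open>0\<close> of functions are pointwise throughout.
  A tangent vector at \<open>p\<close> is a derivation at \<open>p\<close> of the algebra of smooth functions. As HOL
  functions are total, it is extended by \<open>0\<close> to all other functions, so that equality of
  tangent vectors is HOL equality.
\<close>

type_synonym 'm tvec = "('m \<Rightarrow> real) \<Rightarrow> real"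
type_synonym 'm vfield = "'m \<Rightarrow> 'm tvec"

definition tscale :: "real \<Rightarrow> 'm tvec \<Rightarrow> 'm tvec" where
  "tscale c v = (\<lambda>u. c * v u)"

definition tangent_space ::
    "('m::topological_space, 'e::euclidean_space) chart set \<Rightarrow> 'm \<Rightarrow> 'm tvec set" where
  "tangent_space A p = {v.
     (\<forall>u\<in>smooth_funs A. \<forall>w\<in>smooth_funs A. v (u + w) = v u + v w) \<and>
     (\<forall>c. \<forall>u\<in>smooth_funs A. v (\<lambda>x. c * u x) = c * v u) \<and>
     (\<forall>u\<in>smooth_funs A. \<forall>w\<in>smooth_funs A. v (u * w) = u p * v w + w p * v u) \<and>
     (\<forall>u. u \<notin> smooth_funs A \<longrightarrow> v u = 0)}"

text \<open>The function \<open>X(u)\<close> obtained by differentiating \<open>u\<close> along \<open>X\<close>.\<close>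

definition dir :: "'m vfield \<Rightarrow> ('m \<Rightarrow> real) \<Rightarrow> 'm \<Rightarrow> real" where
  "dir X u = (\<lambda>p. X p u)"

definition vector_fields ::
    "('m::topological_space, 'e::euclidean_space) chart set \<Rightarrow> 'm vfield set" where
  "vector_fields A = {X. (\<forall>p. X p \<in> tangent_space A p) \<and>
     (\<forall>u\<in>smooth_funs A. dir X u \<in> smooth_funs A)}"

definition fscale :: "('m \<Rightarrow> real) \<Rightarrow> 'm vfield \<Rightarrow> 'm vfield" where
  "fscale u X = (\<lambda>p. tscale (u p) (X p))"

definition bracket :: "'m vfield \<Rightarrow> 'm vfield \<Rightarrow> 'm vfield" where
  "bracket X Y = (\<lambda>p u. X p (dir Y u) - Y p (dir X u))"


section \<open>Tensor fields\<close>

text \<open>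
  Tensor fields are families of (multi)linear maps on the tangent spaces; smoothness means that
  smooth vector fields are mapped to smooth objects. Values outside the tangent spaces are
  irrelevant.
\<close>

type_synonym 'm endo_field = "'m \<Rightarrow> 'm tvec \<Rightarrow> 'm tvec"
type_synonym 'm one_form = "'m \<Rightarrow> 'm tvec \<Rightarrow> real"
type_synonym 'm bilinear_field = "'m \<Rightarrow> 'm tvec \<Rightarrow> 'm tvec \<Rightarrow> real"

definition app :: "('m \<Rightarrow> 'm tvec \<Rightarrow> 'b) \<Rightarrow> 'm vfield \<Rightarrow> 'm \<Rightarrow> 'b" where
  "app T X = (\<lambda>p. T p (X p))"

definition app2 :: "'m bilinear_field \<Rightarrow> 'm vfield \<Rightarrow> 'm vfield \<Rightarrow> 'm \<Rightarrow> real" where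
  "app2 g X Y = (\<lambda>p. g p (X p) (Y p))"

definition tangent_endo ::
    "('m::topological_space, 'e::euclidean_space) chart set \<Rightarrow> 'm \<Rightarrow> ('m tvec \<Rightarrow> 'm tvec) \<Rightarrow> bool" where
  "tangent_endo A p L \<longleftrightarrow>
     (\<forall>v\<in>tangent_space A p. L v \<in> tangent_space A p) \<and>
     (\<forall>v\<in>tangent_space A p. \<forall>w\<in>tangent_space A p. L (v + w) = L v + L w) \<and>
     (\<forall>c. \<forall>v\<in>tangent_space A p. L (tscale c v) = tscale c (L v))"

definition tangent_functional ::
    "('m::topological_space, 'e::euclidean_space) chart set \<Rightarrow> 'm \<Rightarrow> ('m tvec \<Rightarrow> real) \<Rightarrow> bool" where
  "tangent_functional A p L \<longleftrightarrow>
     (\<forall>v\<in>tangent_space A p. \<forall>w\<in>tangent_space A p. L (v + w) = L v + L w) \<and>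
     (\<forall>c. \<forall>v\<in>tangent_space A p. L (tscale c v) = c * L v)"

definition smooth_endo ::
    "('m::topological_space, 'e::euclidean_space) chart set \<Rightarrow> 'm endo_field \<Rightarrow> bool" where
  "smooth_endo A F \<longleftrightarrow>
     (\<forall>p. tangent_endo A p (F p)) \<and> (\<forall>X\<in>vector_fields A. app F X \<in> vector_fields A)"

definition nonsingular ::
    "('m::topological_space, 'e::euclidean_space) chart set \<Rightarrow> 'm endo_field \<Rightarrow> bool" where
  "nonsingular A F \<longleftrightarrow> (\<forall>p. bij_betw (F p) (tangent_space A p) (tangent_space A p))"

definition smooth_one_form ::
    "('m::topological_space, 'e::euclidean_space) chart set \<Rightarrow> 'm one_form \<Rightarrow> bool" where
  "smooth_one_form A \<eta> \<longleftrightarrow>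
     (\<forall>p. tangent_functional A p (\<eta> p)) \<and> (\<forall>X\<in>vector_fields A. app \<eta> X \<in> smooth_funs A)"

definition riemannian_metric ::
    "('m::topological_space, 'e::euclidean_space) chart set \<Rightarrow> 'm bilinear_field \<Rightarrow> bool" where
  "riemannian_metric A g \<longleftrightarrow>
     (\<forall>p. \<forall>v\<in>tangent_space A p. tangent_functional A p (g p v)) \<and>
     (\<forall>p. \<forall>v\<in>tangent_space A p. \<forall>w\<in>tangent_space A p. g p v w = g p w v) \<and>
     (\<forall>p. \<forall>v\<in>tangent_space A p. v \<noteq> 0 \<longrightarrow> g p v v > 0) \<and>
     (\<forall>X\<in>vector_fields A. \<forall>Y\<in>vector_fields A. app2 g X Y \<in> smooth_funs A)"


section \<open>Levi-Civita connection\<close>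

type_synonym 'm connection = "'m vfield \<Rightarrow> 'm vfield \<Rightarrow> 'm vfield"

text \<open>\<open>D X Y\<close> is the covariant derivative of \<open>Y\<close> in the direction \<open>X\<close>.\<close>

definition affine_connection ::
    "('m::topological_space, 'e::euclidean_space) chart set \<Rightarrow> 'm connection \<Rightarrow> bool" where
  "affine_connection A D \<longleftrightarrow>
     (\<forall>X\<in>vector_fields A. \<forall>Y\<in>vector_fields A. D X Y \<in> vector_fields A) \<and>
     (\<forall>X\<in>vector_fields A. \<forall>X'\<in>vector_fields A. \<forall>Y\<in>vector_fields A.
        D (X + X') Y = D X Y + D X' Y) \<and>
     (\<forall>u\<in>smooth_funs A. \<forall>X\<in>vector_fields A. \<forall>Y\<in>vector_fields A.
        D (fscale u X) Y = fscale u (D X Y)) \<and>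
     (\<forall>X\<in>vector_fields A. \<forall>Y\<in>vector_fields A. \<forall>Y'\<in>vector_fields A.
        D X (Y + Y') = D X Y + D X Y') \<and>
     (\<forall>u\<in>smooth_funs A. \<forall>X\<in>vector_fields A. \<forall>Y\<in>vector_fields A.
        D X (fscale u Y) = fscale (dir X u) Y + fscale u (D X Y))"

definition levi_civita ::
    "('m::topological_space, 'e::euclidean_space) chart set \<Rightarrow> 'm bilinear_field \<Rightarrow>
     'm connection \<Rightarrow> bool" where
  "levi_civita A g D \<longleftrightarrow> affine_connection A D \<and>
     (\<forall>X\<in>vector_fields A. \<forall>Y\<in>vector_fields A. D X Y - D Y X = bracket X Y) \<and>
     (\<forall>X\<in>vector_fields A. \<forall>Y\<in>vector_fields A. \<forall>Z\<in>vector_fields A.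
        dir X (app2 g Y Z) = app2 g (D X Y) Z + app2 g Y (D X Z))"

definition cov_deriv_endo ::
    "'m connection \<Rightarrow> 'm vfield \<Rightarrow> 'm endo_field \<Rightarrow> 'm vfield \<Rightarrow> 'm vfield" where
  "cov_deriv_endo D Z F X = D Z (app F X) - app F (D Z X)"


section \<open>Weak almost-contact metric structures\<close>

definition weak_almost_contact_metric ::
    "('m::topological_space, 'e::euclidean_space) chart set \<Rightarrow> 'm endo_field \<Rightarrow> 'm endo_field \<Rightarrow>
     'm vfield \<Rightarrow> 'm one_form \<Rightarrow> 'm bilinear_field \<Rightarrow> bool" where
  "weak_almost_contact_metric A f Q \<xi> \<eta> g \<longleftrightarrow>
     smooth_endo A f \<and> smooth_endo A Q \<and> nonsingular A Q \<and> \<xi> \<in> vector_fields A \<and>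
     smooth_one_form A \<eta> \<and> riemannian_metric A g \<and>
     (\<forall>p. \<forall>v\<in>tangent_space A p. f p (f p v) = - Q p v + tscale (\<eta> p v) (\<xi> p)) \<and>
     (\<forall>p. \<eta> p (\<xi> p) = 1) \<and>
     (\<forall>p. \<forall>v\<in>tangent_space A p. \<forall>w\<in>tangent_space A p.
        g p (f p v) (f p w) = g p v (Q p w) - \<eta> p v * \<eta> p w) \<and>
     (\<forall>p. \<forall>v\<in>tangent_space A p. \<eta> p v = g p (\<xi> p) v)"

definition lie_deriv_endo :: "'m vfield \<Rightarrow> 'm endo_field \<Rightarrow> 'm vfield \<Rightarrow> 'm vfield" where
  "lie_deriv_endo Z F X = bracket Z (app F X) - app F (bracket Z X)"

definition lie_deriv_form :: "'m vfield \<Rightarrow> 'm one_form \<Rightarrow> 'm vfield \<Rightarrow> 'm \<Rightarrow> real" where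
  "lie_deriv_form Z \<eta> X = dir Z (app \<eta> X) - app \<eta> (bracket Z X)"

text \<open>The exterior derivative with the factor \<open>1/2\<close>.\<close>

definition ext_deriv :: "'m one_form \<Rightarrow> 'm vfield \<Rightarrow> 'm vfield \<Rightarrow> 'm \<Rightarrow> real" where
  "ext_deriv \<eta> X Y = (\<lambda>p.
     (dir X (app \<eta> Y) p - dir Y (app \<eta> X) p - app \<eta> (bracket X Y) p) / 2)"

definition h_tensor :: "'m endo_field \<Rightarrow> 'm vfield \<Rightarrow> 'm vfield \<Rightarrow> 'm vfield" where
  "h_tensor f \<xi> X = (\<lambda>p. tscale (1/2) (lie_deriv_endo \<xi> f X p))"

text \<open>
  The tensor \<open>N\<^sup>2(X,Y) = (L\<^bsub>fX\<^esub> \<eta>)(Y) - (L\<^bsub>fY\<^esub> \<eta>)(X) = 2 d\<eta>(fX,Y) - 2 d\<eta>(fY,X)\<close>. The two expressions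
  differ by \<open>X(\<eta>(fY)) - Y(\<eta>(fX))\<close>, so they agree when \<open>\<eta> \<circ> f = 0\<close> (see \<open>N2_eq_lie_deriv\<close> below).
  That identity does not follow from \<open>weak_almost_contact_metric\<close> unless, e.g., \<open>Q \<xi> = \<xi>\<close>
  is assumed as well (see \<open>eta_f_eq_0\<close> below), and without it the first expression is not
  tensorial. The second one always is.
\<close>

definition N2 :: "'m one_form \<Rightarrow> 'm endo_field \<Rightarrow> 'm vfield \<Rightarrow> 'm vfield \<Rightarrow> 'm \<Rightarrow> real" where
  "N2 \<eta> f X Y = (\<lambda>p. 2 * ext_deriv \<eta> (app f X) Y p - 2 * ext_deriv \<eta> (app f Y) X p)"

lemma eta_f_eq_0:
  fixes A :: "('m::topological_space, 'e::euclidean_space) chart set"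
  assumes W: "weak_almost_contact_metric A f Q \<xi> \<eta> g"
    and Q\<xi>: "Q p (\<xi> p) = \<xi> p" and v: "v \<in> tangent_space A p"
  shows "\<eta> p (f p v) = 0"
proof -
  let ?T = "tangent_space A p"
  note W = W[unfolded weak_almost_contact_metric_def]
  have fE: "tangent_endo A p (f p)" and QE: "tangent_endo A p (Q p)"
    using W by (simp_all add: smooth_endo_def)
  have \<eta>F: "tangent_functional A p (\<eta> p)" using W by (simp add: smooth_one_form_def)
  have gF: "\<And>v. v \<in> ?T \<Longrightarrow> tangent_functional A p (g p v)"
    and gsym: "\<And>v w. v \<in> ?T \<Longrightarrow> w \<in> ?T \<Longrightarrow> g p v w = g p w v"
    and pos: "\<And>v. v \<in> ?T \<Longrightarrow> v \<noteq> 0 \<Longrightarrow> g p v v > 0"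
    using W by (simp_all add: riemannian_metric_def)
  have \<xi>: "\<xi> p \<in> ?T" using W by (simp add: vector_fields_def)
  have fT: "f p v \<in> ?T" and fadd: "w \<in> ?T \<Longrightarrow> f p (v + w) = f p v + f p w"
    and fscale: "f p (tscale c v) = tscale c (f p v)" if "v \<in> ?T" for v w c
    using fE that by (simp_all add: tangent_endo_def)
  have QT: "Q p v \<in> ?T" if "v \<in> ?T" for v using QE that by (simp add: tangent_endo_def)
  have \<eta>add: "w \<in> ?T \<Longrightarrow> \<eta> p (v + w) = \<eta> p v + \<eta> p w"
    and \<eta>scale: "\<eta> p (tscale c v) = c * \<eta> p v" if "v \<in> ?T" for v w c
    using \<eta>F that by (simp_all add: tangent_functional_def)
  have f2: "f p (f p v) = - Q p v + tscale (\<eta> p v) (\<xi> p)" if "v \<in> ?T" for v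
    using W that by simp
  have ff: "g p (f p v) (f p w) = g p v (Q p w) - \<eta> p v * \<eta> p w" if "v \<in> ?T" "w \<in> ?T" for v w
    using W that by simp
  have \<eta>g: "\<eta> p v = g p (\<xi> p) v" if "v \<in> ?T" for v using W that by simp
  have \<eta>\<xi>: "\<eta> p (\<xi> p) = 1" using W by simp
  have "g p (f p (\<xi> p)) (f p (\<xi> p)) = 0"
    using ff[OF \<xi> \<xi>] \<eta>g[OF \<xi>] by (simp add: Q\<xi> \<eta>\<xi>)
  then have f\<xi>: "f p (\<xi> p) = 0" using pos[OF fT[OF \<xi>]] by force
  have sc0: "tscale c 0 = (0 :: 'm tvec)" for c by (simp add: tscale_def fun_eq_iff)
  have zT: "(0 :: 'm tvec) \<in> ?T" by (simp add: tangent_space_def)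
  have gz: "g p 0 v = 0" if "v \<in> ?T" for v
  proof -
    have "g p v (tscale 0 0) = 0 * g p v 0"
      using gF[OF that] zT unfolding tangent_functional_def by blast
    moreover have "g p 0 v = g p v 0" using gsym that zT by blast
    ultimately show ?thesis by (simp add: sc0)
  qed
  have \<eta>Q: "\<eta> p (Q p v) = \<eta> p v" if v: "v \<in> ?T" for v
  proof -
    have "g p (f p (\<xi> p)) (f p v) = 0" using gz[OF fT[OF v]] by (simp add: f\<xi>)
    then show ?thesis using ff[OF \<xi> v] \<eta>g[OF QT[OF v]] \<eta>\<xi> by simp
  qed
  have "Q p ` ?T = ?T" using W by (simp add: nonsingular_def bij_betw_def)
  then obtain u where u: "u \<in> ?T" and vu: "v = Q p u" using v by blast
  have eq: "f p (f p u) + v = tscale (\<eta> p u) (\<xi> p)" using f2[OF u] vu by (simp add: fun_eq_iff)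
  have "f p (f p (f p u)) + f p v = tscale (\<eta> p u) (f p (\<xi> p))"
    using fadd[OF fT[OF fT[OF u]] v] fscale[OF \<xi>] eq by simp
  then have a: "\<eta> p (f p (f p (f p u))) + \<eta> p (f p v) = 0"
    using \<eta>add[OF fT[OF fT[OF fT[OF u]]] fT[OF v]] f\<xi> sc0 \<eta>scale[OF zT, of 0] by simp
  have "f p (f p (f p u)) + Q p (f p u) = tscale (\<eta> p (f p u)) (\<xi> p)"
    using f2[OF fT[OF u]] by (simp add: fun_eq_iff)
  then have "\<eta> p (f p (f p (f p u))) + \<eta> p (Q p (f p u)) = \<eta> p (f p u)"
    using \<eta>add[OF fT[OF fT[OF fT[OF u]]] QT[OF fT[OF u]]] \<eta>scale[OF \<xi>] \<eta>\<xi> by simp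
  with \<eta>Q[OF fT[OF u]] a show ?thesis by simp
qed

lemma N2_eq_lie_deriv:
  assumes "X \<in> vector_fields A" "Y \<in> vector_fields A" "smooth_endo A f"
    and "\<forall>p. \<forall>v\<in>tangent_space A p. \<eta> p (f p v) = 0"
  shows "N2 \<eta> f X Y = lie_deriv_form (app f X) \<eta> Y - lie_deriv_form (app f Y) \<eta> X"
proof -
  have z: "dir Z 0 = 0" if Z: "Z \<in> vector_fields A" for Z
  proof -
    have "Z p 0 = 0" for p
    proof (cases "0 \<in> smooth_funs A")
      case True
      moreover have "Z p \<in> tangent_space A p" using Z by (simp add: vector_fields_def)
      ultimately have "Z p (\<lambda>x. 0 * 0 x) = 0 * Z p 0" unfolding tangent_space_def by blast
      then show ?thesis by (simp add: zero_fun_def)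
    next
      case False
      moreover have "Z p \<in> tangent_space A p" using Z by (simp add: vector_fields_def)
      ultimately show ?thesis unfolding tangent_space_def by blast
    qed
    then show ?thesis by (simp add: dir_def fun_eq_iff)
  qed
  have e: "app \<eta> (app f Z) = 0" if "Z \<in> vector_fields A" for Z
    using that assms(4) by (simp add: app_def vector_fields_def fun_eq_iff)
  show ?thesis
    by (simp add: N2_def ext_deriv_def lie_deriv_form_def e z assms fun_eq_iff field_simps)
qed

definition self_adjoint_op ::
    "('m::topological_space, 'e::euclidean_space) chart set \<Rightarrow> 'm bilinear_field \<Rightarrow>
     ('m vfield \<Rightarrow> 'm vfield) \<Rightarrow> bool" where
  "self_adjoint_op A g H \<longleftrightarrow>
     (\<forall>X\<in>vector_fields A. \<forall>Y\<in>vector_fields A. app2 g (H X) Y = app2 g X (H Y))"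

end

theory Submission
  imports Defs
begin

text \<open>
  Since \<open>\<nabla>\<close> is torsion free, \<open>(L\<^bsub>\<xi>\<^esub> f)X = (\<nabla>\<^bsub>\<xi>\<^esub> f)X - \<nabla>\<^bsub>fX\<^esub> \<xi> + f(\<nabla>\<^bsub>X\<^esub> \<xi>)\<close>. If the first summand vanishes,
  only first derivatives of \<open>\<xi>\<close> remain, and when \<open>f\<close> is skew-symmetric they combine to
  \<open>2 g(hX,Y) = - g(\<nabla>\<^bsub>fX\<^esub> \<xi>, Y) - g(\<nabla>\<^bsub>X\<^esub> \<xi>, fY)\<close>. On the other hand, as \<open>\<eta>\<close> is dual to \<open>\<xi>\<close> and \<open>\<nabla>\<close> is
  metric and torsion free, \<open>2 d\<eta>(X,Y) = g(\<nabla>\<^bsub>X\<^esub> \<xi>, Y) - g(\<nabla>\<^bsub>Y\<^esub> \<xi>, X)\<close> (lemma \<open>ext_deriv_dual_form\<close>).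
  Antisymmetrizing the former identity in \<open>X, Y\<close> yields exactly the four terms that the latter
  contributes to \<open>- N\<^sup>2(X,Y)\<close>.

  What remains is the skew-symmetry of \<open>f\<close> (lemma \<open>weak_almost_contact_metric_skew\<close>). The usual
  argument obtains it from \<open>Q \<xi> = \<xi>\<close>, but that equation is not a consequence of the axioms in
  \<open>weak_almost_contact_metric\<close>: for any skew-symmetric \<open>f\<close> of rank \<open>2n\<close> with kernel not orthogonal to
  the unit vector \<open>\<xi>\<close>, the choice \<open>Q = - f\<^sup>2 + \<eta> \<otimes> \<xi>\<close> satisfies them, and \<open>Q \<xi> = \<xi>\<close> only if
  \<open>f \<xi> = 0\<close>. Skew-symmetry does follow, by pointwise linear algebra from the surjectivity of \<open>Q\<close>.
\<close>


section \<open>Linear algebra in a tangent space\<close>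

lemma tangent_space_add:
  assumes "v \<in> tangent_space A p" "w \<in> tangent_space A p"
  shows "v + w \<in> tangent_space A p"
  using assms by (simp add: tangent_space_def algebra_simps)

lemma tangent_space_tscale:
  assumes "v \<in> tangent_space A p"
  shows "tscale c v \<in> tangent_space A p"
  using assms by (simp add: tangent_space_def tscale_def algebra_simps)

lemma diff_eq_add_tscale: "v - w = v + tscale (-1) w"
  by (simp add: tscale_def fun_eq_iff)

lemma tangent_space_diff:
  assumes "v \<in> tangent_space A p" "w \<in> tangent_space A p"
  shows "v - w \<in> tangent_space A p"
  unfolding diff_eq_add_tscale by (intro tangent_space_add tangent_space_tscale assms)

lemma tangent_space_zero: "0 \<in> tangent_space A p"
  by (simp add: tangent_space_def)

lemma tangent_functional_diff:
  assumes "tangent_functional A p L" "v \<in> tangent_space A p" "w \<in> tangent_space A p"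
  shows "L (v - w) = L v - L w"
  using assms tangent_space_tscale[of w A p "-1"]
  by (simp add: diff_eq_add_tscale tangent_functional_def)

lemma tangent_functional_zero:
  assumes "tangent_functional A p L"
  shows "L 0 = 0"
  using tangent_functional_diff[OF assms tangent_space_zero tangent_space_zero] by simp

lemma tangent_endo_diff:
  assumes "tangent_endo A p L" "v \<in> tangent_space A p" "w \<in> tangent_space A p"
  shows "L (v - w) = L v - L w"
  using assms tangent_space_tscale[of w A p "-1"]
  by (simp add: diff_eq_add_tscale tangent_endo_def)

lemma vector_field_tangent: "X \<in> vector_fields A \<Longrightarrow> X p \<in> tangent_space A p"
  by (simp add: vector_fields_def)

lemma riemannian_metric_sym:
  assumes "riemannian_metric A g" "v \<in> tangent_space A p" "w \<in> tangent_space A p"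
  shows "g p v w = g p w v"
  using assms by (simp add: riemannian_metric_def)

lemma riemannian_metric_functional:
  assumes "riemannian_metric A g" "v \<in> tangent_space A p"
  shows "tangent_functional A p (g p v)"
  using assms by (simp add: riemannian_metric_def)

lemma riemannian_metric_functional_left:
  assumes g: "riemannian_metric A g" and w: "w \<in> tangent_space A p"
  shows "tangent_functional A p (\<lambda>v. g p v w)"
  using riemannian_metric_functional[OF g w]
  by (simp add: tangent_functional_def riemannian_metric_sym[OF g _ w]
      tangent_space_add tangent_space_tscale)

lemma riemannian_metric_definite:
  assumes "riemannian_metric A g" "v \<in> tangent_space A p" "g p v v = 0"
  shows "v = 0"
  using assms unfolding riemannian_metric_def by (metis less_irrefl)


section \<open>Skew-symmetry of the structure tensor\<close>

text \<open>
  Let \<open>S(v,w) = g(fv,w) + g(v,fw)\<close>. The two axioms involving \<open>Q\<close> give \<open>g(fv,fw) = - g(v,f\<^sup>2w)\<close>, that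
  is, \<open>S(v,fw) = 0\<close>. As \<open>Q\<close> is onto and \<open>Q = - f\<^sup>2 + \<eta> \<otimes> \<xi>\<close>, every vector is a multiple of \<open>\<xi>\<close> up to
  an element of the image of \<open>f\<close>, so only \<open>S(\<xi>,\<xi>) = 0\<close> is left to show. Choose \<open>u\<close> with \<open>Qu = \<xi>\<close>;
  then \<open>f\<^sup>2u = (\<eta>(u) - 1)\<xi>\<close>. Either this exhibits \<open>\<xi>\<close> as an element of the image of \<open>f\<close>, or
  \<open>f\<^sup>2u = 0\<close>; in the latter case \<open>fu = 0\<close>, hence \<open>S(u,u) = 0\<close>. The vector \<open>u \<noteq> 0\<close> is orthogonal to the
  image of \<open>f\<^sup>2\<close>, so its component along \<open>\<xi>\<close> is nonzero and \<open>S(u,u)\<close> is a nonzero multiple of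
  \<open>S(\<xi>,\<xi>)\<close>.
\<close>

lemma weak_almost_contact_metric_skew:
  fixes A :: "('m::topological_space, 'e::euclidean_space) chart set"
  assumes W: "weak_almost_contact_metric A f Q \<xi> \<eta> g"
    and v: "v \<in> tangent_space A p" and w: "w \<in> tangent_space A p"
  shows "g p (f p v) w = - g p v (f p w)"
proof -
  let ?T = "tangent_space A p"
  define S where "S v w = g p (f p v) w + g p v (f p w)" for v w
  note W = W[unfolded weak_almost_contact_metric_def]
  have g: "riemannian_metric A g" using W by simp
  have fE: "tangent_endo A p (f p)" and QE: "tangent_endo A p (Q p)"
    using W by (simp_all add: smooth_endo_def)
  have \<xi>: "\<xi> p \<in> ?T" using W by (simp add: vector_field_tangent)
  have fT: "f p x \<in> ?T" and QT: "Q p x \<in> ?T" if "x \<in> ?T" for x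
    using fE QE that by (simp_all add: tangent_endo_def)
  have fadd: "f p (x + y) = f p x + f p y" if "x \<in> ?T" "y \<in> ?T" for x y
    using fE that by (simp add: tangent_endo_def)
  have fsc: "f p (tscale c x) = tscale c (f p x)" if "x \<in> ?T" for x c
    using fE that by (simp add: tangent_endo_def)
  have gadd: "g p x (y + z) = g p x y + g p x z" and gsc: "g p x (tscale c y) = c * g p x y"
    if "x \<in> ?T" "y \<in> ?T" "z \<in> ?T" for x y z c
    using riemannian_metric_functional[OF g that(1)] that by (simp_all add: tangent_functional_def)
  note gsym = riemannian_metric_sym[OF g]
  note gz = tangent_functional_zero[OF riemannian_metric_functional[OF g]]
  have f2: "f p (f p x) = tscale (\<eta> p x) (\<xi> p) - Q p x" if "x \<in> ?T" for x
    using W that by simp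
  have \<eta>g: "\<eta> p x = g p (\<xi> p) x" if "x \<in> ?T" for x using W that by simp
  have ff: "g p (f p x) (f p y) = - g p x (f p (f p y))" if x: "x \<in> ?T" and y: "y \<in> ?T" for x y
  proof -
    have "g p x (f p (f p y)) = \<eta> p y * g p x (\<xi> p) - g p x (Q p y)"
      using tangent_functional_diff[OF riemannian_metric_functional[OF g x]
          tangent_space_tscale[OF \<xi>] QT[OF y]] gsc[OF x \<xi> \<xi>] f2[OF y] by simp
    moreover have "g p (f p x) (f p y) = g p x (Q p y) - \<eta> p x * \<eta> p y" using W x y by simp
    ultimately show ?thesis using \<eta>g[OF x] gsym[OF x \<xi>] by simp
  qed
  have Ssym: "S x y = S y x" if "x \<in> ?T" "y \<in> ?T" for x y
    unfolding S_def using gsym fT that by simp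
  have Sim: "S x (f p y) = 0" if "x \<in> ?T" "y \<in> ?T" for x y
    unfolding S_def using ff that by simp
  have Sadd: "S x (y + z) = S x y + S x z" if "x \<in> ?T" "y \<in> ?T" "z \<in> ?T" for x y z
    unfolding S_def using that by (simp add: fadd gadd fT)
  have Ssc: "S x (tscale c y) = c * S x y" if "x \<in> ?T" "y \<in> ?T" for x y c
    unfolding S_def using that by (simp add: fsc gsc fT algebra_simps)
  have "Q p ` ?T = ?T" using W by (simp add: nonsingular_def bij_betw_def)
  then have Qonto: "\<exists>u\<in>?T. Q p u = x" if "x \<in> ?T" for x using that by (metis imageE)
  have decomp: "x = tscale (\<eta> p u) (\<xi> p) + f p (tscale (-1) (f p u))"
    if "u \<in> ?T" "Q p u = x" for x u
    unfolding fsc[OF fT[OF that(1)]] f2[OF that(1)] that(2) by (simp add: tscale_def fun_eq_iff)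
  have Sred: "S y x = \<eta> p u * S y (\<xi> p)" if y: "y \<in> ?T" and u: "u \<in> ?T" "Q p u = x" for x y u
  proof -
    have m: "tscale (-1) (f p u) \<in> ?T" by (intro tangent_space_tscale fT u)
    have "S y x = S y (tscale (\<eta> p u) (\<xi> p)) + S y (f p (tscale (-1) (f p u)))"
      using Sadd[OF y tangent_space_tscale[OF \<xi>] fT[OF m]] decomp[OF u] by simp
    then show ?thesis using Sim[OF y m] Ssc[OF y \<xi>] by simp
  qed
  have S\<xi>: "S (\<xi> p) (\<xi> p) = 0"
  proof -
    obtain u where u: "u \<in> ?T" "Q p u = \<xi> p" using Qonto[OF \<xi>] by blast
    show ?thesis
    proof (cases "\<eta> p u = 1")
      case False
      then show ?thesis using Sred[OF \<xi> u] by simp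
    next
      case True
      have "f p (f p u) = 0" using f2[OF u(1)] u(2) True by (simp add: tscale_def fun_eq_iff)
      then have "g p (f p u) (f p u) = 0" using ff[OF u(1) u(1)] gz[OF u(1)] by simp
      then have fu: "f p u = 0" by (rule riemannian_metric_definite[OF g fT[OF u(1)]])
      obtain u' where u': "u' \<in> ?T" "Q p u' = u" using Qonto[OF u(1)] by blast
      have "\<eta> p u' \<noteq> 0"
      proof
        assume "\<eta> p u' = 0"
        then have "u = f p (tscale (-1) (f p u'))" using decomp[OF u'] by (simp add: tscale_def fun_eq_iff)
        then have "g p u u = g p u (tscale (-1) (f p (f p u')))"
          using fsc[OF fT[OF u'(1)], of "-1"] by simp
        also have "\<dots> = g p (f p u) (f p u')"
          using gsc[OF u(1) fT[OF fT[OF u'(1)]] u(1)] ff[OF u(1) u'(1)] by simp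
        also have "\<dots> = g p (f p u') (f p u)" using gsym fT u(1) u'(1) by blast
        also have "\<dots> = 0" using gz[OF fT[OF u'(1)]] fu by simp
        finally have "u = 0" by (rule riemannian_metric_definite[OF g u(1)])
        then show False using True \<eta>g[OF u(1)] gz[OF \<xi>] by simp
      qed
      moreover have "S u u = \<eta> p u' * (\<eta> p u' * S (\<xi> p) (\<xi> p))"
        using Sred[OF u(1) u'] Sred[OF \<xi> u'] Ssym[OF u(1) \<xi>] by simp
      moreover have "S u u = 0"
        using gz[OF u(1)] gsym[OF u(1) tangent_space_zero] by (simp add: S_def fu)
      ultimately show ?thesis by simp
    qed
  qed
  obtain a where a: "a \<in> ?T" "Q p a = v" using Qonto[OF v] by blast
  obtain b where b: "b \<in> ?T" "Q p b = w" using Qonto[OF w] by blast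
  have "S v w = \<eta> p b * (\<eta> p a * S (\<xi> p) (\<xi> p))"
    using Sred[OF v b] Sred[OF \<xi> a] Ssym[OF v \<xi>] by simp
  then show ?thesis using S\<xi> by (simp add: S_def)
qed


section \<open>Derivatives of the characteristic field\<close>

lemma levi_civita_bracket:
  assumes "levi_civita A g D" "X \<in> vector_fields A" "Y \<in> vector_fields A"
  shows "bracket X Y p = D X Y p - D Y X p"
proof -
  have "bracket X Y = D X Y - D Y X" using assms by (simp add: levi_civita_def)
  then show ?thesis by simp
qed

lemma levi_civita_closed:
  assumes "levi_civita A g D" "X \<in> vector_fields A" "Y \<in> vector_fields A"
  shows "D X Y \<in> vector_fields A"
  using assms by (simp add: levi_civita_def affine_connection_def)

lemma ext_deriv_dual_form:
  assumes g: "riemannian_metric A g" and D: "levi_civita A g D"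
    and \<xi>: "\<xi> \<in> vector_fields A"
    and dual: "\<forall>p. \<forall>v\<in>tangent_space A p. \<eta> p v = g p (\<xi> p) v"
    and X: "X \<in> vector_fields A" and Y: "Y \<in> vector_fields A"
  shows "2 * ext_deriv \<eta> X Y p = g p (D X \<xi> p) (Y p) - g p (D Y \<xi> p) (X p)"
proof -
  note DT = vector_field_tangent[OF levi_civita_closed[OF D]]
  have d: "dir Z (app \<eta> V) p = g p (D Z \<xi> p) (V p) + g p (\<xi> p) (D Z V p)"
    if Z: "Z \<in> vector_fields A" and V: "V \<in> vector_fields A" for Z V
  proof -
    have "app \<eta> V = app2 g \<xi> V"
      using dual vector_field_tangent[OF V] by (simp add: app_def app2_def)
    moreover have "dir Z (app2 g \<xi> V) = app2 g (D Z \<xi>) V + app2 g \<xi> (D Z V)"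
      using D Z V \<xi> by (simp add: levi_civita_def)
    ultimately show ?thesis by (simp add: app2_def)
  qed
  have "app \<eta> (bracket X Y) p = g p (\<xi> p) (D X Y p) - g p (\<xi> p) (D Y X p)"
    using dual tangent_space_diff[OF DT[OF X Y] DT[OF Y X]]
      tangent_functional_diff[OF riemannian_metric_functional[OF g vector_field_tangent[OF \<xi>]]
        DT[OF X Y] DT[OF Y X]]
    by (simp add: app_def levi_civita_bracket[OF D X Y])
  then show ?thesis by (simp add: ext_deriv_def d[OF X Y] d[OF Y X])
qed

lemma lie_deriv_endo_parallel:
  assumes D: "levi_civita A g D" and F: "smooth_endo A F"
    and Z: "Z \<in> vector_fields A" and X: "X \<in> vector_fields A"
    and parallel: "cov_deriv_endo D Z F X = 0"
  shows "lie_deriv_endo Z F X p = F p (D X Z p) - D (app F X) Z p"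
proof -
  have FX: "app F X \<in> vector_fields A" and FE: "tangent_endo A p (F p)"
    using F X by (simp_all add: smooth_endo_def)
  note DT = vector_field_tangent[OF levi_civita_closed[OF D]]
  have "D Z (app F X) p = F p (D Z X p)"
    using fun_cong[OF parallel, of p] by (simp add: cov_deriv_endo_def app_def)
  moreover have "app F (bracket Z X) p = F p (D Z X p) - F p (D X Z p)"
    using tangent_endo_diff[OF FE DT[OF Z X] DT[OF X Z]]
    by (simp add: app_def levi_civita_bracket[OF D Z X])
  ultimately show ?thesis
    by (simp add: lie_deriv_endo_def levi_civita_bracket[OF D Z FX])
qed


section \<open>The antisymmetric part of \<open>h\<close>\<close>

theorem proposition2:
  fixes A :: "('m::{t2_space, second_countable_topology}, 'e::euclidean_space) chart set"
    and n :: nat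
    and f Q :: "'m endo_field" and \<xi> :: "'m vfield" and \<eta> :: "'m one_form"
    and g :: "'m bilinear_field" and D :: "'m connection"
  assumes manifold: "smooth_atlas A" and dim: "DIM('e) = 2 * n + 1"
    and wacm: "weak_almost_contact_metric A f Q \<xi> \<eta> g"
    and levi_civita: "levi_civita A g D"
    and parallel: "\<forall>X\<in>vector_fields A. cov_deriv_endo D \<xi> f X = 0"
  shows "(\<forall>X\<in>vector_fields A. \<forall>Y\<in>vector_fields A. \<forall>p.
            app2 g (h_tensor f \<xi> X) Y p - app2 g (h_tensor f \<xi> Y) X p = - (1/2) * N2 \<eta> f X Y p)
       \<and> (self_adjoint_op A g (h_tensor f \<xi>) \<longleftrightarrow>
            (\<forall>X\<in>vector_fields A. \<forall>Y\<in>vector_fields A. N2 \<eta> f X Y = 0))"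
proof -
  note W = wacm[unfolded weak_almost_contact_metric_def]
  have g: "riemannian_metric A g" and f: "smooth_endo A f" and \<xi>: "\<xi> \<in> vector_fields A"
    and dual: "\<forall>p. \<forall>v\<in>tangent_space A p. \<eta> p v = g p (\<xi> p) v"
    using W by simp_all
  note DV = levi_civita_closed[OF levi_civita]
  note DT = vector_field_tangent[OF DV]
  have fV: "app f X \<in> vector_fields A" if "X \<in> vector_fields A" for X
    using f that by (simp add: smooth_endo_def)
  have fT: "f p v \<in> tangent_space A p" if "v \<in> tangent_space A p" for p v
    using f that by (simp add: smooth_endo_def tangent_endo_def)
  have h: "h_tensor f \<xi> X p = tscale (1/2) (f p (D X \<xi> p) - D (app f X) \<xi> p)"
    if "X \<in> vector_fields A" for X p
    using lie_deriv_endo_parallel[OF levi_civita f \<xi> that] parallel that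
    by (simp add: h_tensor_def)
  have hT: "h_tensor f \<xi> X p \<in> tangent_space A p" if X: "X \<in> vector_fields A" for X p
    unfolding h[OF X] by (intro tangent_space_tscale tangent_space_diff fT DT X \<xi> fV)
  have gh: "app2 g (h_tensor f \<xi> X) Y p
      = - (g p (D (app f X) \<xi> p) (Y p) + g p (D X \<xi> p) (app f Y p)) / 2"
    if X: "X \<in> vector_fields A" and Y: "Y \<in> vector_fields A" for X Y p
  proof -
    note YT = vector_field_tangent[OF Y, of p]
    note L = riemannian_metric_functional_left[OF g YT]
    have "app2 g (h_tensor f \<xi> X) Y p = (1/2) * g p (f p (D X \<xi> p) - D (app f X) \<xi> p) (Y p)"
      using L tangent_space_diff[OF fT[OF DT[OF X \<xi>]] DT[OF fV[OF X] \<xi>]]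
      by (simp add: app2_def h[OF X] tangent_functional_def)
    also have "\<dots> = (1/2) * (g p (f p (D X \<xi> p)) (Y p) - g p (D (app f X) \<xi> p) (Y p))"
      using tangent_functional_diff[OF L fT[OF DT[OF X \<xi>]] DT[OF fV[OF X] \<xi>]] by simp
    also have "g p (f p (D X \<xi> p)) (Y p) = - g p (D X \<xi> p) (app f Y p)"
      using weak_almost_contact_metric_skew[OF wacm DT[OF X \<xi>] YT] by (simp add: app_def)
    finally show ?thesis by simp
  qed
  have d\<eta>: "2 * ext_deriv \<eta> X Y p = g p (D X \<xi> p) (Y p) - g p (D Y \<xi> p) (X p)"
    if "X \<in> vector_fields A" "Y \<in> vector_fields A" for X Y p
    by (rule ext_deriv_dual_form[where A = A and g = g and D = D and \<xi> = \<xi> and \<eta> = \<eta>])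
      (use g levi_civita \<xi> dual that in blast)+
  have main: "app2 g (h_tensor f \<xi> X) Y p - app2 g (h_tensor f \<xi> Y) X p = - (1/2) * N2 \<eta> f X Y p"
    if X: "X \<in> vector_fields A" and Y: "Y \<in> vector_fields A" for X Y p
  proof -
    have "N2 \<eta> f X Y p = (g p (D (app f X) \<xi> p) (Y p) - g p (D Y \<xi> p) (app f X p))
        - (g p (D (app f Y) \<xi> p) (X p) - g p (D X \<xi> p) (app f Y p))"
      unfolding N2_def d\<eta>[OF fV[OF X] Y] d\<eta>[OF fV[OF Y] X] ..
    then show ?thesis unfolding gh[OF X Y] gh[OF Y X] by (simp add: field_simps)
  qed
  have "app2 g (h_tensor f \<xi> X) Y = app2 g X (h_tensor f \<xi> Y) \<longleftrightarrow> N2 \<eta> f X Y = 0"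
    if X: "X \<in> vector_fields A" and Y: "Y \<in> vector_fields A" for X Y
  proof -
    have "app2 g X (h_tensor f \<xi> Y) p = app2 g (h_tensor f \<xi> Y) X p" for p
      using riemannian_metric_sym[OF g vector_field_tangent[OF X] hT[OF Y]]
      by (simp add: app2_def)
    then have "app2 g (h_tensor f \<xi> X) Y p = app2 g X (h_tensor f \<xi> Y) p \<longleftrightarrow> N2 \<eta> f X Y p = 0" for p
      using main[OF X Y, of p] by auto
    then show ?thesis by (simp add: fun_eq_iff)
  qed
  with main show ?thesis by (simp add: self_adjoint_op_def)
qed

end
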